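(* Let $p,q\in T((\mathbb R^d))$ with $q^{\emptyset}\ne1$. Then the unique solution $\ell\in T((\mathbb R^d))$ of the linear algebraic equation $$\ell=p+\ell q$$ is given by $$\ell=p(\emptyset-q)^{-1}.$$
   Context: Let $d\in\mathbb N$, $d\ge1$. $V_n$ is the set of words of length $n$ in the letters $\mathbf 1,\dots,\mathbf d$, with $V_0=\{\emptyset\}$ (empty word). $T((\mathbb R^d))$ is the extended tensor algebra, i.e. the space of formal series $\ell=\sum_{n\ge0}\sum_{v\in V_n}\ell^vv$ with $\ell^v\in\mathbb R$. The product $\ell\varphi=\ell\otimes\varphi$ is concatenation, $(\ell\varphi)^w=\sum_{uv=w}\ell^u\varphi^v$, with unit $\emptyset$; $\ell^{\otimes n}$ is the $n$-th power and $\ell^{\otimes0}=\emptyset$. For $q$ with $q^\emptyset\ne1$ the resolvent is $$(\emptyset-q)^{-1}:=\sum_{n=0}^\infty\frac{1}{(1-q^\emptyset)^{n+1}}\,(q-q^\emptyset\emptyset)^{\otimes n},$$ which reduces to $\sum_{n\ge0}q^{\otimes n}$ when $q^\emptyset=0$. *)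

theory Defs
  imports Complex_Main
begin

text \<open>
  The alphabet of \<open>d\<close> letters is a type \<^typ>\<open>'d\<close> of class \<^class>\<open>finite\<close> with \<open>d\<close> elements
  (such a type is nonempty, so \<open>d \<ge> 1\<close>); words are lists of letters, the empty word is \<^term>\<open>[]\<close>.
  A formal series is determined by its family of coefficients, on which no condition is imposed.
  The typedef, rather than the plain function type, keeps the concatenation product apart from
  pointwise multiplication.
\<close>

typedef 'd tensor_series = "UNIV :: ('d::finite list \<Rightarrow> real) set"
  morphisms coeff Tensor_Series ..

declare Tensor_Series_inverse [OF UNIV_I, simp]

lemma tensor_series_eqI: "(\<And>w. coeff l w = coeff m w) \<Longrightarrow> l = m"
  by (metis coeff_inject ext)

lemma finite_splits: "finite {(u, v). u @ v = w}"
proof -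
  have "{(u, v). u @ v = w} \<subseteq> (\<lambda>k. (take k w, drop k w)) ` {..length w}"
  proof (clarify)
    fix u v assume "w = u @ v"
    then show "(u, v) \<in> (\<lambda>k. (take k (u @ v), drop k (u @ v))) ` {..length (u @ v)}"
      by (intro image_eqI[where x = "length u"]) auto
  qed
  then show ?thesis
    by (rule finite_subset) simp
qed

instantiation tensor_series :: (finite) "{real_vector, times, one}"
begin

definition "0 = Tensor_Series (\<lambda>w. 0)"
definition "l + m = Tensor_Series (\<lambda>w. coeff l w + coeff m w)"
definition "- l = Tensor_Series (\<lambda>w. - coeff l w)"
definition "l - m = Tensor_Series (\<lambda>w. coeff l w - coeff m w)"
definition "c *\<^sub>R l = Tensor_Series (\<lambda>w. c * coeff l w)"
definition "1 = Tensor_Series (\<lambda>w. if w = [] then 1 else 0)"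
definition "l * m = Tensor_Series (\<lambda>w. \<Sum>(u, v)\<in>{(u, v). u @ v = w}. coeff l u * coeff m v)"

instance
  by standard
    (auto intro!: tensor_series_eqI simp: zero_tensor_series_def plus_tensor_series_def
      uminus_tensor_series_def minus_tensor_series_def scaleR_tensor_series_def algebra_simps)

end

lemma coeff_simps [simp]:
  "coeff 0 w = 0"
  "coeff (l + m) w = coeff l w + coeff m w"
  "coeff (- l) w = - coeff l w"
  "coeff (l - m) w = coeff l w - coeff m w"
  "coeff (c *\<^sub>R l) w = c * coeff l w"
  "coeff 1 w = (if w = [] then 1 else 0)"
  by (simp_all add: zero_tensor_series_def plus_tensor_series_def uminus_tensor_series_def
      minus_tensor_series_def scaleR_tensor_series_def one_tensor_series_def)

lemma coeff_mult:
  "coeff (l * m) w = (\<Sum>(u, v)\<in>{(u, v). u @ v = w}. coeff l u * coeff m v)"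
  by (simp add: times_tensor_series_def)

instance tensor_series :: (finite) real_algebra_1
proof
  fix a b c :: "'a tensor_series" and r :: real
  show "a * b * c = a * (b * c)"
  proof (rule tensor_series_eqI)
    fix w
    have "coeff (a * b * c) w =
        (\<Sum>(x, v)\<in>{(x, v). x @ v = w}. \<Sum>(s, t)\<in>{(s, t). s @ t = x}. coeff a s * coeff b t * coeff c v)"
      by (simp add: coeff_mult sum_distrib_right case_prod_unfold)
    also have "\<dots> = (\<Sum>((x, v), (s, t))\<in>Sigma {(x, v). x @ v = w} (\<lambda>(x, v). {(s, t). s @ t = x}).
        coeff a s * coeff b t * coeff c v)"
      by (subst sum.Sigma[symmetric]) (auto simp: finite_splits case_prod_unfold finite_splits[unfolded case_prod_unfold])
    also have "\<dots> = (\<Sum>((s, y), (t, v))\<in>Sigma {(s, y). s @ y = w} (\<lambda>(s, y). {(t, v). t @ v = y}).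
        coeff a s * coeff b t * coeff c v)"
      by (rule sum.reindex_bij_witness[where
            i = "\<lambda>((s, y), (t, v)). ((s @ t, v), (s, t))" and
            j = "\<lambda>((x, v), (s, t)). ((s, t @ v), (t, v))"]) auto
    also have "\<dots> = (\<Sum>(s, y)\<in>{(s, y). s @ y = w}. \<Sum>(t, v)\<in>{(t, v). t @ v = y}.
        coeff a s * coeff b t * coeff c v)"
      by (subst sum.Sigma[symmetric]) (auto simp: finite_splits case_prod_unfold finite_splits[unfolded case_prod_unfold])
    also have "\<dots> = coeff (a * (b * c)) w"
      by (simp add: coeff_mult sum_distrib_left case_prod_unfold mult.assoc)
    finally show "coeff (a * b * c) w = coeff (a * (b * c)) w" .
  qed
  show "(a + b) * c = a * c + b * c" "a * (b + c) = a * b + a * c"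
    by (auto intro!: tensor_series_eqI
        simp: coeff_mult case_prod_unfold algebra_simps sum.distrib)
  show "r *\<^sub>R a * b = r *\<^sub>R (a * b)" "a * r *\<^sub>R b = r *\<^sub>R (a * b)"
    by (auto intro!: tensor_series_eqI
        simp: coeff_mult case_prod_unfold sum_distrib_left mult.left_commute mult.assoc)
  show "1 * a = a"
  proof (rule tensor_series_eqI)
    fix w
    have "coeff (1 * a) w = (\<Sum>(u, v)\<in>{([], w)}. coeff (1 :: 'a tensor_series) u * coeff a v)"
      unfolding coeff_mult by (rule sum.mono_neutral_right) (auto simp: finite_splits split: if_splits)
    then show "coeff (1 * a) w = coeff a w" by simp
  qed
  show "a * 1 = a"
  proof (rule tensor_series_eqI)
    fix w
    have "coeff (a * 1) w = (\<Sum>(u, v)\<in>{(w, [])}. coeff a u * coeff (1 :: 'a tensor_series) v)"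
      unfolding coeff_mult by (rule sum.mono_neutral_right) (auto simp: finite_splits split: if_splits)
    then show "coeff (a * 1) w = coeff a w" by simp
  qed
  show "(0 :: 'a tensor_series) \<noteq> 1"
    by (metis coeff_simps(1) coeff_simps(6) zero_neq_one)
qed

text \<open>
  The resolvent \<open>(\<emptyset> - q)\<^sup>-\<^sup>1\<close>. The infinite sum of formal series is taken coefficientwise; by
  \<open>coeff_power_eq_0\<close> below every coefficient involves only finitely many nonzero terms.
\<close>

definition resolvent :: "'d::finite tensor_series \<Rightarrow> 'd tensor_series" where
  "resolvent q = Tensor_Series (\<lambda>w. \<Sum>n.
     coeff ((1 / (1 - coeff q []) ^ (n + 1)) *\<^sub>R (q - coeff q [] *\<^sub>R 1) ^ n) w)"

lemma coeff_power_eq_0: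
  assumes "coeff x [] = 0" and "length w < n"
  shows "coeff (x ^ n) w = 0"
  using assms(2)
proof (induction n arbitrary: w)
  case (Suc n)
  have "coeff x u * coeff (x ^ n) v = 0" if "u @ v = w" for u v
  proof (cases "u = []")
    case False
    then have "length v < n"
      using that Suc.prems by (cases u) auto
    then show ?thesis
      using Suc.IH by simp
  qed (simp add: assms(1))
  then show ?case
    by (auto simp: coeff_mult intro!: sum.neutral)
qed simp

lemma resolvent_sums:
  "(\<lambda>n. coeff ((1 / (1 - coeff q []) ^ (n + 1)) *\<^sub>R (q - coeff q [] *\<^sub>R 1) ^ n) w)
     sums coeff (resolvent q) w"
proof -
  have "summable (\<lambda>n. coeff ((1 / (1 - coeff q []) ^ (n + 1)) *\<^sub>R (q - coeff q [] *\<^sub>R 1) ^ n) w)"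
    by (rule summable_finite[where N = "{..length w}"]) (auto simp: coeff_power_eq_0)
  then show ?thesis
    by (simp add: resolvent_def summable_sums)
qed

end

theory Submission
  imports Defs
begin

text \<open>
  The equation \<open>l = p + l * q\<close> says \<open>l * (1 - q) = p\<close>, so everything rests on the resolvent being a
  two-sided inverse of \<open>1 - q\<close>: the right-hand inverse \<open>(1 - q) * resolvent q = 1\<close> forces
  \<open>l = p * resolvent q\<close>, and the left-hand one shows that this series is a solution. The
  algebra is noncommutative, so neither identity gives the other for free.

  With \<open>c = 1 - coeff q []\<close> and \<open>x = q - coeff q [] *\<^sub>R 1\<close> one has \<open>1 - q = c *\<^sub>R 1 - x\<close>, and the resolvent is
  the geometric series of \<open>x / c\<close> divided by \<open>c\<close>. Its partial sums telescope against \<open>1 - q\<close> up to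
  a multiple of \<open>x ^ N\<close>. No limit has to be exchanged with a product: the coefficient of a product
  at a word depends only on coefficients of the factors at words that are no longer, and there both
  the tail of the series and the remainder \<open>x ^ N\<close> vanish once \<open>N\<close> exceeds the length of the word.
\<close>

lemma coeff_sum: "coeff (\<Sum>n\<in>A. f n) w = (\<Sum>n\<in>A. coeff (f n) w)"
  by (induction A rule: infinite_finite_induct) auto

text \<open>
  A word splits only into words that are no longer than itself. Hence series may be truncated
  before they are multiplied.
\<close>

lemma coeff_mult_cong:
  assumes "\<And>u. length u \<le> length w \<Longrightarrow> coeff l u = coeff l' u"
    and "\<And>v. length v \<le> length w \<Longrightarrow> coeff m v = coeff m' v"
  shows "coeff (l * m) w = coeff (l' * m') w"
  unfolding coeff_mult by (rule sum.cong) (auto simp: assms)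

definition resolvent_partial_sum :: "'d::finite tensor_series \<Rightarrow> nat \<Rightarrow> 'd tensor_series" where
  "resolvent_partial_sum q N =
    (\<Sum>n<N. (1 / (1 - coeff q []) ^ (n + 1)) *\<^sub>R (q - coeff q [] *\<^sub>R 1) ^ n)"

lemma coeff_resolvent_eq_partial_sum:
  assumes "length w < N"
  shows "coeff (resolvent q) w = coeff (resolvent_partial_sum q N) w"
proof -
  let ?f = "\<lambda>n. coeff ((1 / (1 - coeff q []) ^ (n + 1)) *\<^sub>R (q - coeff q [] *\<^sub>R 1) ^ n) w"
  have "?f sums (\<Sum>n<N. ?f n)"
    by (rule sums_finite) (use assms in \<open>auto simp: coeff_power_eq_0\<close>)
  with resolvent_sums have "coeff (resolvent q) w = (\<Sum>n<N. ?f n)"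
    by (rule sums_unique2)
  then show ?thesis
    by (simp add: resolvent_partial_sum_def coeff_sum)
qed

text \<open>
  Geometric sums telescope in any real algebra, since powers of \<open>x\<close> commute with \<open>x\<close>.
\<close>

lemma geometric_sum_telescope:
  fixes x :: "'a::real_algebra_1"
  assumes "c \<noteq> 0"
  shows "(\<Sum>n<N. (1 / c ^ (n + 1)) *\<^sub>R x ^ n) * (c *\<^sub>R 1 - x) = 1 - (1 / c ^ N) *\<^sub>R x ^ N"
    and "(c *\<^sub>R 1 - x) * (\<Sum>n<N. (1 / c ^ (n + 1)) *\<^sub>R x ^ n) = 1 - (1 / c ^ N) *\<^sub>R x ^ N"
proof -
  have *: "((1 / c ^ (n + 1)) *\<^sub>R x ^ n) * (c *\<^sub>R 1 - x) =
      (1 / c ^ n) *\<^sub>R x ^ n - (1 / c ^ Suc n) *\<^sub>R x ^ Suc n"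
    "(c *\<^sub>R 1 - x) * ((1 / c ^ (n + 1)) *\<^sub>R x ^ n) =
      (1 / c ^ n) *\<^sub>R x ^ n - (1 / c ^ Suc n) *\<^sub>R x ^ Suc n" for n
    using assms by (simp_all add: algebra_simps power_commutes)
  show "(\<Sum>n<N. (1 / c ^ (n + 1)) *\<^sub>R x ^ n) * (c *\<^sub>R 1 - x) = 1 - (1 / c ^ N) *\<^sub>R x ^ N"
    unfolding sum_distrib_right * by (subst sum_lessThan_telescope') simp
  show "(c *\<^sub>R 1 - x) * (\<Sum>n<N. (1 / c ^ (n + 1)) *\<^sub>R x ^ n) = 1 - (1 / c ^ N) *\<^sub>R x ^ N"
    unfolding sum_distrib_left * by (subst sum_lessThan_telescope') simp
qed

lemma resolvent_inverse:
  fixes q :: "'d::finite tensor_series"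
  assumes "coeff q [] \<noteq> 1"
  shows "resolvent q * (1 - q) = 1" and "(1 - q) * resolvent q = 1"
proof -
  define c where "c = 1 - coeff q []"
  define x where "x = q - coeff q [] *\<^sub>R 1"
  have "c \<noteq> 0" and x0: "coeff x [] = 0" and q: "1 - q = c *\<^sub>R 1 - x"
    using assms by (simp_all add: c_def x_def algebra_simps)
  have S: "resolvent_partial_sum q N = (\<Sum>n<N. (1 / c ^ (n + 1)) *\<^sub>R x ^ n)" for N
    by (simp add: resolvent_partial_sum_def c_def x_def)
  note telescope = geometric_sum_telescope[OF \<open>c \<noteq> 0\<close>, of x, folded S q]
  have remainder: "coeff (1 - (1 / c ^ N) *\<^sub>R x ^ N) w = coeff 1 w" if "length w < N" for w N
    using that by (simp add: coeff_power_eq_0[OF x0])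
  show "resolvent q * (1 - q) = 1"
  proof (rule tensor_series_eqI)
    fix w :: "'d list"
    let ?N = "Suc (length w)"
    have "coeff (resolvent q * (1 - q)) w = coeff (resolvent_partial_sum q ?N * (1 - q)) w"
      by (intro coeff_mult_cong coeff_resolvent_eq_partial_sum) auto
    also have "\<dots> = coeff 1 w"
      unfolding telescope by (rule remainder) simp
    finally show "coeff (resolvent q * (1 - q)) w = coeff 1 w" .
  qed
  show "(1 - q) * resolvent q = 1"
  proof (rule tensor_series_eqI)
    fix w :: "'d list"
    let ?N = "Suc (length w)"
    have "coeff ((1 - q) * resolvent q) w = coeff ((1 - q) * resolvent_partial_sum q ?N) w"
      by (intro coeff_mult_cong coeff_resolvent_eq_partial_sum) auto
    also have "\<dots> = coeff 1 w"
      unfolding telescope by (rule remainder) simp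
    finally show "coeff ((1 - q) * resolvent q) w = coeff 1 w" .
  qed
qed

theorem proposition2p2:
  fixes p q :: "'d::finite tensor_series"
  assumes "coeff q [] \<noteq> 1"
  shows "(\<exists>!l. l = p + l * q) \<and>
    p * resolvent q = p + (p * resolvent q) * q"
proof -
  note inverse = resolvent_inverse[OF assms]
  have eq_iff: "l = p + l * q \<longleftrightarrow> l * (1 - q) = p" for l
    by (simp add: right_diff_distrib diff_eq_eq)
  have solution: "p * resolvent q = p + (p * resolvent q) * q"
    unfolding eq_iff by (simp add: mult.assoc inverse)
  have unique: "l = p * resolvent q" if "l = p + l * q" for l
  proof -
    have "l = l * ((1 - q) * resolvent q)"
      by (simp add: inverse)
    also have "\<dots> = p * resolvent q"
      using that unfolding eq_iff by (simp add: mult.assoc[symmetric])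
    finally show ?thesis .
  qed
  from solution unique show ?thesis
    by blast
qed

end
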